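(* Let $f : M=\Lambda \times V \rightarrow \mathbb{R}^n$ be a parameterized vector field with $k$ independent first integrals satisfying the setting and the non-degeneracy conditions i), ii), iii) recalled in the context. If $f$ is analytic, then the equilibrium locus $E = f^{-1}(0)$ is a smooth real analytic variety of dimension $m+k$.
   Context: Setting. Let $n,m,k>0$ be integers. $\Lambda\subset\mathbb{R}^m$ is a connected open set. $V\subset\mathbb{R}^n$ is a compact submanifold of codimension zero whose boundary $\partial V$ is a stratified manifold. $M=\Lambda\times V$, and $f:M\to\mathbb{R}^n$ is a smooth map, regarded as a family of vector fields $f(\lambda,\cdot)$ on $V$ defining the systems $\dot x=f(\lambda,x)$. The system stays inside $V$: on $\partial V$ the vector field either points inward or is tangent to $\partial V$. There are $k$ smooth functions $h_1,\dots,h_k:\mathbb{R}^n\to\mathbb{R}$, not depending on $\lambda$, which are first integrals (for each $\lambda\in\Lambda$ each $h_l$ is constant along every solution $x(t)$ in $V$ of $\dot x=f(\lambda,x)$) and are independent, i.e. their gradients $\nabla h_1,\dots,\nabla h_k$ are linearly independent at every point. The equilibrium locus is $E=\{(\lambda,x)\in M: f(\lambda,x)=0\}$, assumed nonempty. Non-degeneracy conditions. i) The rank of the matrix $\frac{\partial f}{\partial\lambda}$ is constant equal to $\min(m,n-k)$. ii) The rank of the matrix $\frac{\partial f}{\partial x}$ is constant equal to $n-k$ for $(\lambda,x)\in E$, and equals $n-p(\lambda,x)$ at points $(\lambda,x)\notin E$, where $p(\lambda,x)\le k$. iii) For every $(\lambda,x)\in E$, $\ker\left(\frac{\partial f}{\partial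 x}(\lambda,x)\right)\oplus\operatorname{im}\left(\frac{\partial f}{\partial x}(\lambda,x)\right)=\mathbb{R}^n$.
   Formalization: At points with x in the boundary of V, E is only shown to be locally the intersection of M with a smooth analytic submanifold of dimension m+k; there E itself may have smaller dimension, so the claim read literally fails. Over the interior of V it is the full claim. *)

theory Defs
  imports "HOL-Analysis.Analysis"
begin

section \<open>Smooth and real analytic maps\<close>

text \<open>Intended for open \<^term>\<open>S\<close>, where this is continuous differentiability of order \<^term>\<open>r\<close>.\<close>

primrec Cr_on ::
    "nat \<Rightarrow> 'a::euclidean_space set \<Rightarrow> ('a \<Rightarrow> 'b::real_normed_vector) \<Rightarrow> bool" where
  "Cr_on 0 S f \<longleftrightarrow> continuous_on S f"
| "Cr_on (Suc r) S f \<longleftrightarrow>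
     f differentiable_on S \<and> (\<forall>v. Cr_on r S (\<lambda>x. frechet_derivative f (at x) v))"

text \<open>As with \<^const>\<open>analytic_on\<close> in the library, smoothness and analyticity on a set that
  need not be open (such as \<open>\<Lambda> \<times> V\<close> with \<open>V\<close> compact) refer to an open
  neighbourhood of that set; at boundary points the function \<^term>\<open>f\<close> stands for the given
  map together with such an extension. On the closure of an open set, all derivatives of the
  extension are determined by the original map.\<close>

definition smooth_on_set :: "('a::euclidean_space \<Rightarrow> 'b::real_normed_vector) \<Rightarrow> 'a set \<Rightarrow> bool" where
  "smooth_on_set f S \<longleftrightarrow> (\<exists>U. open U \<and> S \<subseteq> U \<and> (\<forall>r. Cr_on r U f))"

definition multi_indices :: "('a::euclidean_space \<Rightarrow> nat) set" where
  "multi_indices = {\<alpha>. \<forall>b. b \<notin> Basis \<longrightarrow> \<alpha> b = 0}"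

definition real_analytic_at :: "('a::euclidean_space \<Rightarrow> 'b::real_normed_vector) \<Rightarrow> 'a \<Rightarrow> bool" where
  "real_analytic_at f p \<longleftrightarrow>
     (\<exists>r>0. \<exists>c. \<forall>x\<in>ball p r.
        ((\<lambda>\<alpha>. (\<Prod>b\<in>Basis. ((x - p) \<bullet> b) ^ \<alpha> b) *\<^sub>R c \<alpha>) has_sum f x) multi_indices)"

definition real_analytic_on_set :: "('a::euclidean_space \<Rightarrow> 'b::real_normed_vector) \<Rightarrow> 'a set \<Rightarrow> bool" where
  "real_analytic_on_set f S \<longleftrightarrow> (\<forall>p\<in>S. real_analytic_at f p)"

definition gradient :: "('a::real_inner \<Rightarrow> real) \<Rightarrow> 'a \<Rightarrow> 'a" where
  "gradient f x = (THE D. GDERIV f x :> D)"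

definition independent_family :: "('i \<Rightarrow> 'a::real_vector) \<Rightarrow> 'i set \<Rightarrow> bool" where
  "independent_family v I \<longleftrightarrow> inj_on v I \<and> independent (v ` I)"


section \<open>Smooth submanifolds and smooth real analytic varieties\<close>

text \<open>Near each of its points, the set \<^term>\<open>S\<close> is the set of points of \<^term>\<open>M\<close> at which
  \<open>codim = DIM('a) - d\<close> functions with independent gradients, taken from the class \<^term>\<open>C\<close>,
  vanish. If \<^term>\<open>M\<close> is open this says that \<^term>\<open>S\<close> is an embedded submanifold of
  dimension \<^term>\<open>d\<close>. At a point of \<^term>\<open>M\<close> outside its interior it says that \<^term>\<open>S\<close> is
  locally the intersection of \<^term>\<open>M\<close> with such a submanifold.\<close>

definition regular_locus_in ::
    "(('a::euclidean_space \<Rightarrow> real) \<Rightarrow> 'a set \<Rightarrow> bool) \<Rightarrow> nat \<Rightarrow> 'a set \<Rightarrow> 'a set \<Rightarrow> bool" where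
  "regular_locus_in C d M S \<longleftrightarrow>
     d \<le> DIM('a) \<and> S \<subseteq> M \<and>
     (\<forall>p\<in>S. \<exists>U g. open U \<and> p \<in> U \<and>
        (\<forall>i<DIM('a) - d. C (g i) U) \<and>
        (\<forall>q\<in>U. independent_family (\<lambda>i. gradient (g i) q) {..<DIM('a) - d}) \<and>
        S \<inter> U = {q \<in> M \<inter> U. \<forall>i<DIM('a) - d. g i q = 0})"

definition smooth_submanifold :: "nat \<Rightarrow> 'a::euclidean_space set \<Rightarrow> bool" where
  "smooth_submanifold d S \<longleftrightarrow> regular_locus_in smooth_on_set d UNIV S"

definition smooth_analytic_variety_in :: "nat \<Rightarrow> 'a::euclidean_space set \<Rightarrow> 'a set \<Rightarrow> bool" where
  "smooth_analytic_variety_in d M S \<longleftrightarrow>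
     closedin (top_of_set M) S \<and> regular_locus_in real_analytic_on_set d M S"


section \<open>The domain of the state variable\<close>

text \<open>Submanifold of codimension zero, with boundary, in the topological sense, so that edges
  and corners are permitted. By invariance of domain its boundary points, if it is closed, are
  exactly the points of its \<^const>\<open>frontier\<close>.\<close>

definition codim_zero_submanifold :: "(real^'n) set \<Rightarrow> bool" where
  "codim_zero_submanifold V \<longleftrightarrow>
     (\<forall>x\<in>V. \<exists>U W i. openin (top_of_set V) U \<and> x \<in> U \<and>
        openin (top_of_set {y::real^'n. 0 \<le> y $ i}) W \<and> U homeomorphic W)"

text \<open>Intended for compact sets, for which local finiteness of the stratification is
  finiteness. No regularity condition of Whitney type is imposed.\<close>

definition stratified_manifold :: "'a::euclidean_space set \<Rightarrow> bool" where
  "stratified_manifold B \<longleftrightarrow>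
     (\<exists>\<S>. finite \<S> \<and> disjoint \<S> \<and> \<Union>\<S> = B \<and>
        (\<forall>S\<in>\<S>. \<exists>d. smooth_submanifold d S) \<and>
        (\<forall>S\<in>\<S>. \<forall>T\<in>\<S>. S \<inter> closure T \<noteq> {} \<longrightarrow> S \<subseteq> closure T))"

text \<open>The contingent (Bouligand) cone; at a smooth point of \<^term>\<open>S\<close> it is the tangent space.\<close>

definition tangent_cone :: "'a::real_normed_vector set \<Rightarrow> 'a \<Rightarrow> 'a set" where
  "tangent_cone S x =
     {v. \<exists>y t. (\<forall>i::nat. y i \<in> S \<and> 0 < t i) \<and> y \<longlonglongrightarrow> x \<and> t \<longlonglongrightarrow> 0 \<and>
        (\<lambda>i. (y i - x) /\<^sub>R t i) \<longlonglongrightarrow> v}"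

definition points_inward :: "'a::real_normed_vector set \<Rightarrow> 'a \<Rightarrow> 'a \<Rightarrow> bool" where
  "points_inward V x v \<longleftrightarrow> (\<exists>\<epsilon>>0. \<forall>t\<in>{0<..<\<epsilon>}. x + t *\<^sub>R v \<in> interior V)"


section \<open>Solutions and first integrals\<close>

definition solution_in ::
    "'a::real_normed_vector set \<Rightarrow> ('a \<Rightarrow> 'a) \<Rightarrow> real set \<Rightarrow> (real \<Rightarrow> 'a) \<Rightarrow> bool" where
  "solution_in V F J x \<longleftrightarrow>
     is_interval J \<and> (\<forall>t\<in>J. x t \<in> V \<and> (x has_vector_derivative F (x t)) (at t within J))"

definition first_integral_on ::
    "'a::real_normed_vector set \<Rightarrow> ('a \<Rightarrow> 'a) \<Rightarrow> ('a \<Rightarrow> real) \<Rightarrow> bool" where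
  "first_integral_on V F h \<longleftrightarrow>
     (\<forall>J x. solution_in V F J x \<longrightarrow> (\<lambda>t. h (x t)) constant_on J)"


section \<open>Jacobian matrices\<close>

definition jac_param :: "((real^'m) \<times> (real^'n) \<Rightarrow> real^'n) \<Rightarrow> (real^'m) \<times> (real^'n) \<Rightarrow> real^'m^'n" where
  "jac_param f p = jacobian (\<lambda>\<mu>. f (\<mu>, snd p)) (at (fst p))"

definition jac_state :: "((real^'m) \<times> (real^'n) \<Rightarrow> real^'n) \<Rightarrow> (real^'m) \<times> (real^'n) \<Rightarrow> real^'n^'n" where
  "jac_state f p = jacobian (\<lambda>y. f (fst p, y)) (at (snd p))"

definition direct_sum_UNIV :: "'a::real_vector set \<Rightarrow> 'a set \<Rightarrow> bool" where
  "direct_sum_UNIV K L \<longleftrightarrow> K \<inter> L = {0} \<and> {u + v | u v. u \<in> K \<and> v \<in> L} = UNIV"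

end

theory Submission
  imports Defs
begin

text \<open>
  Fix an equilibrium \<open>p = (\<lambda>, x)\<close>. There are \<open>n\<close> equations \<open>f = 0\<close>, but an
  equilibrium locus of dimension \<open>m + k\<close> has to be cut out by \<open>n - k\<close> of them. The first
  integrals explain why \<open>k\<close> equations are redundant: as \<open>h\<^sub>i\<close> is constant along
  solutions, \<open>\<nabla>h\<^sub>i(x) \<bullet> f(\<lambda>, x) = 0\<close>, so \<open>f(\<lambda>, x)\<close> takes its values in the
  space \<open>K(x)\<close> orthogonal to all \<open>\<nabla>h\<^sub>i(x)\<close>, which has dimension \<open>n - k\<close>.

  Differentiating this identity in \<open>x\<close> at an equilibrium, where the term containing second
  derivatives of \<open>h\<^sub>i\<close> carries the factor \<open>f = 0\<close>, shows that the image \<open>W\<close> of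
  \<open>\<partial>f/\<partial>x\<close> at \<open>p\<close> lies in \<open>K(x)\<close>. By the rank condition on \<open>E\<close> both spaces have dimension
  \<open>n - k\<close>, so they coincide. Let \<open>w\<^sub>i\<close> be a basis of \<open>W\<close> and take the equations
  \<open>g\<^sub>i = f \<bullet> w\<^sub>i\<close>. Two facts hold at \<open>p\<close>, and each of them says that a linear map
  which depends continuously on the point is injective on a fixed subspace, hence they persist
  near \<open>p\<close> (\<open>linear_injective_on_subspace_nearby\<close>):

  \<^item> The gradients of the \<open>g\<^sub>i\<close> are independent, since \<open>u \<mapsto> \<nabla>(f \<bullet> u)\<close> is injective on
    the image \<open>W\<close> of \<open>\<partial>f/\<partial>x\<close>.
  \<^item> A vector that is orthogonal to \<open>W\<close> and to all \<open>\<nabla>h\<^sub>i\<close> is zero. Applied to the value of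
    \<open>f\<close> at a nearby point of \<open>\<Lambda> \<times> V\<close>, it says that the equations \<open>g\<^sub>i = 0\<close> imply \<open>f = 0\<close>.

  Three ingredients support this. The identity \<open>\<nabla>h\<^sub>i \<bullet> f = 0\<close> requires that solutions exist
  (\<open>picard_lindelof\<close>); they stay in \<open>V\<close> for a short time from interior points, and the
  remaining points of \<open>V\<close> are limits of interior points by invariance of domain
  (\<open>codim_zero_submanifold_subset_closure_interior\<close>). That the \<open>g\<^sub>i\<close> are analytic on a whole
  neighbourhood of \<open>p\<close> follows by expanding a power series about a new centre
  (\<open>real_analytic_at_nearby\<close>).
\<close>

section \<open>Real analyticity is an open condition\<close>

definition monomial :: "'a::euclidean_space \<Rightarrow> ('a \<Rightarrow> nat) \<Rightarrow> real" where
  "monomial x \<alpha> = (\<Prod>b\<in>Basis. (x \<bullet> b) ^ \<alpha> b)"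

text \<open>The summands of the expansion of \<open>(y + d)\<^sup>\<alpha>\<close> by the binomial theorem in each coordinate.
  Unless \<open>\<beta> \<le> \<alpha>\<close> in every coordinate the value is \<open>0\<close>, because a binomial coefficient vanishes;
  therefore \<open>\<beta>\<close> can range over all multi-indices, independently of \<open>\<alpha>\<close>, and a double
  sum over \<open>\<alpha>\<close> and \<open>\<beta>\<close> runs over a product.\<close>

definition binomial_term ::
    "'a::euclidean_space \<Rightarrow> 'a \<Rightarrow> ('a \<Rightarrow> nat) \<Rightarrow> ('a \<Rightarrow> nat) \<Rightarrow> real" where
  "binomial_term y d \<alpha> \<beta> =
     (\<Prod>b\<in>Basis. of_nat (\<alpha> b choose \<beta> b) * (y \<bullet> b) ^ \<beta> b * (d \<bullet> b) ^ (\<alpha> b - \<beta> b))"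

lemma binomial_term_has_sum:
  assumes "\<alpha> \<in> multi_indices"
  shows "(binomial_term y d \<alpha> has_sum monomial (y + d) \<alpha>) multi_indices"
proof (rule has_sum_finite_neutralI)
  let ?P = "PiE Basis (\<lambda>b. {..\<alpha> b})"
  let ?ext = "\<lambda>(g::'a \<Rightarrow> nat) b. if b \<in> Basis then g b else 0"
  let ?B = "?ext ` ?P"
  show "finite ?B" by (intro finite_imageI finite_PiE) auto
  show "?B \<subseteq> multi_indices" by (auto simp: multi_indices_def)
  show "binomial_term y d \<alpha> \<beta> = 0" if "\<beta> \<in> multi_indices - ?B" for \<beta>
  proof (rule ccontr)
    assume "binomial_term y d \<alpha> \<beta> \<noteq> 0"
    then have "\<beta> b \<le> \<alpha> b" if "b \<in> Basis" for b
      using that by (auto simp: binomial_term_def)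
    then have "restrict \<beta> Basis \<in> ?P" by (auto simp: PiE_def Pi_def)
    moreover have "\<beta> = ?ext (restrict \<beta> Basis)"
      using that by (auto simp: multi_indices_def fun_eq_iff)
    ultimately have "\<beta> \<in> ?B" by (intro rev_image_eqI)
    with that show False by blast
  qed
  have inj: "inj_on ?ext ?P"
  proof (rule inj_onI)
    fix g g' assume g: "g \<in> ?P" "g' \<in> ?P" and eq: "?ext g = ?ext g'"
    show "g = g'"
    proof (rule PiE_ext[OF g])
      show "g b = g' b" if "b \<in> Basis" for b using fun_cong[OF eq, of b] that by simp
    qed
  qed
  have "monomial (y + d) \<alpha> =
      (\<Prod>b\<in>Basis. \<Sum>j\<le>\<alpha> b. of_nat (\<alpha> b choose j) * (y \<bullet> b) ^ j * (d \<bullet> b) ^ (\<alpha> b - j))"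
    by (simp add: monomial_def inner_add_left binomial_ring)
  also have "\<dots> = (\<Sum>g\<in>?P. \<Prod>b\<in>Basis.
      of_nat (\<alpha> b choose g b) * (y \<bullet> b) ^ g b * (d \<bullet> b) ^ (\<alpha> b - g b))"
    by (rule prod_sum_PiE) auto
  also have "\<dots> = (\<Sum>g\<in>?P. binomial_term y d \<alpha> (?ext g))"
    by (auto simp: binomial_term_def intro!: sum.cong prod.cong)
  also have "\<dots> = sum (binomial_term y d \<alpha>) ?B"
    by (simp add: sum.reindex[OF inj])
  finally show "monomial (y + d) \<alpha> = sum (binomial_term y d \<alpha>) ?B" .
qed

lemma binomial_term_factor:
  "binomial_term y d \<alpha> \<beta> =
     monomial y \<beta> * (\<Prod>b\<in>Basis. of_nat (\<alpha> b choose \<beta> b) * (d \<bullet> b) ^ (\<alpha> b - \<beta> b))"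
  by (simp add: binomial_term_def monomial_def prod.distrib mult_ac)

text \<open>Replacing \<open>y\<close> and \<open>d\<close> by their coordinatewise absolute values turns each
  \<open>binomial_term\<close> into its absolute value without changing a norm, so an absolutely convergent
  majorant comes from evaluating the original series at one more point of the same ball.\<close>

definition coordinate_abs :: "'a::euclidean_space \<Rightarrow> 'a" where
  "coordinate_abs x = (\<Sum>b\<in>Basis. \<bar>x \<bullet> b\<bar> *\<^sub>R b)"

lemma coordinate_abs_inner [simp]: "b \<in> Basis \<Longrightarrow> coordinate_abs x \<bullet> b = \<bar>x \<bullet> b\<bar>"
  by (simp add: coordinate_abs_def inner_sum_left inner_Basis if_distrib cong: if_cong)

lemma norm_coordinate_abs [simp]: "norm (coordinate_abs x) = norm x"
proof -
  have "coordinate_abs x \<bullet> coordinate_abs x = x \<bullet> x"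
    by (simp only: euclidean_inner[of "coordinate_abs x" "coordinate_abs x"] euclidean_inner[of x x]) simp
  then show ?thesis by (simp add: norm_eq_sqrt_inner)
qed

lemma abs_binomial_term:
  "\<bar>binomial_term y d \<alpha> \<beta>\<bar> = binomial_term (coordinate_abs y) (coordinate_abs d) \<alpha> \<beta>"
  by (simp add: binomial_term_def abs_prod abs_mult power_abs)

text \<open>Put \<open>y = x - q\<close> and \<open>d = q - p\<close>, expand each \<open>(y + d)\<^sup>\<alpha>\<close> binomially and sum over \<open>\<alpha>\<close>
  first. The interchange is allowed because the double series converges absolutely: the sum of
  the absolute values is the series of \<open>f\<close>, with its coefficients replaced by their absolute
  values, at the point \<open>coordinate_abs y + coordinate_abs d\<close>, whose norm is less than \<open>r\<close>.
  A convergent unordered sum of real numbers is absolutely convergent.\<close>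

lemma power_series_recentre:
  fixes f :: "'a::euclidean_space \<Rightarrow> real"
  assumes series: "\<And>x. x \<in> ball p r \<Longrightarrow>
      ((\<lambda>\<alpha>. monomial (x - p) \<alpha> * c \<alpha>) has_sum f x) multi_indices"
    and q: "norm (q - p) + norm (x - q) < r"
  shows "((\<lambda>\<beta>. monomial (x - q) \<beta> *
      (\<Sum>\<^sub>\<infinity>\<alpha>\<in>multi_indices. (\<Prod>b\<in>Basis. of_nat (\<alpha> b choose \<beta> b) * ((q - p) \<bullet> b) ^ (\<alpha> b - \<beta> b)) * c \<alpha>))
      has_sum f x) multi_indices"
proof -
  let ?I = "multi_indices :: ('a \<Rightarrow> nat) set"
  define y d where "y = x - q" and "d = q - p"
  define T where "T = (\<lambda>(\<alpha>, \<beta>). binomial_term y d \<alpha> \<beta> * c \<alpha>)"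
  let ?z = "coordinate_abs y + coordinate_abs d"
  have "norm ?z < r"
    using q norm_triangle_ineq[of "coordinate_abs y" "coordinate_abs d"] by (simp add: y_def d_def)
  then have "p + ?z \<in> ball p r"
    by (subst mem_ball, subst dist_commute) (simp add: dist_norm)
  from has_sum_imp_summable[OF series[OF this]]
  have "(\<lambda>\<alpha>. monomial ?z \<alpha> * c \<alpha>) summable_on ?I" by simp
  then have "(\<lambda>\<alpha>. \<bar>monomial ?z \<alpha> * c \<alpha>\<bar>) summable_on ?I"
    unfolding summable_on_iff_abs_summable_on_real[of "\<lambda>\<alpha>. monomial ?z \<alpha> * c \<alpha>"] by simp
  moreover have "0 \<le> monomial ?z \<alpha>" for \<alpha>
    by (simp add: monomial_def inner_add_left prod_nonneg)
  ultimately have majorant: "(\<lambda>\<alpha>. monomial ?z \<alpha> * \<bar>c \<alpha>\<bar>) summable_on ?I"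
    by (simp add: abs_mult)
  have "(\<lambda>ab. \<bar>T ab\<bar>) summable_on ?I \<times> ?I"
  proof (rule summable_on_SigmaI[OF _ majorant])
    fix \<alpha> assume "\<alpha> \<in> ?I"
    from has_sum_cmult_left[OF binomial_term_has_sum[OF this], of "coordinate_abs y" "coordinate_abs d" "\<bar>c \<alpha>\<bar>"]
    show "((\<lambda>\<beta>. \<bar>T (\<alpha>, \<beta>)\<bar>) has_sum monomial ?z \<alpha> * \<bar>c \<alpha>\<bar>) ?I"
      by (simp add: T_def abs_mult abs_binomial_term)
  qed auto
  then have summable: "T summable_on ?I \<times> ?I"
    unfolding summable_on_iff_abs_summable_on_real[of T] by simp
  have total: "(T has_sum f x) (?I \<times> ?I)"
  proof (rule has_sum_SigmaI[OF _ _ summable])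
    show "((\<lambda>\<beta>. T (\<alpha>, \<beta>)) has_sum monomial (y + d) \<alpha> * c \<alpha>) ?I" if "\<alpha> \<in> ?I" for \<alpha>
      using has_sum_cmult_left[OF binomial_term_has_sum[OF that]] by (simp add: T_def)
    have "norm (x - p) < r"
      using q norm_triangle_ineq[of "q - p" "x - q"] by simp
    then show "((\<lambda>\<alpha>. monomial (y + d) \<alpha> * c \<alpha>) has_sum f x) ?I"
      using series[of x] by (simp add: y_def d_def dist_norm norm_minus_commute)
  qed
  let ?T' = "\<lambda>(\<beta>, \<alpha>). T (\<alpha>, \<beta>)"
  have total': "(?T' has_sum f x) (?I \<times> ?I)"
    using total by (subst (asm) has_sum_swap)
  show ?thesis
    unfolding y_def[symmetric] d_def[symmetric]
  proof (rule has_sum_SigmaD[OF total'])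
    fix \<beta> assume "\<beta> \<in> ?I"
    have "(\<lambda>\<alpha>. ?T' (\<beta>, \<alpha>)) summable_on ?I"
      using summable_on_SigmaD1[OF has_sum_imp_summable[OF total'] \<open>\<beta> \<in> ?I\<close>] by simp
    then have "((\<lambda>\<alpha>. ?T' (\<beta>, \<alpha>)) has_sum (\<Sum>\<^sub>\<infinity>\<alpha>\<in>?I. ?T' (\<beta>, \<alpha>))) ?I"
      by (rule has_sum_infsum)
    also have "(\<Sum>\<^sub>\<infinity>\<alpha>\<in>?I. ?T' (\<beta>, \<alpha>)) = monomial y \<beta> *
        (\<Sum>\<^sub>\<infinity>\<alpha>\<in>?I. (\<Prod>b\<in>Basis. of_nat (\<alpha> b choose \<beta> b) * (d \<bullet> b) ^ (\<alpha> b - \<beta> b)) * c \<alpha>)"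
      unfolding infsum_cmult_right'[symmetric]
      by (intro infsum_cong) (simp add: T_def binomial_term_factor mult_ac)
    finally show "((\<lambda>\<alpha>. ?T' (\<beta>, \<alpha>)) has_sum monomial y \<beta> *
        (\<Sum>\<^sub>\<infinity>\<alpha>\<in>?I. (\<Prod>b\<in>Basis. of_nat (\<alpha> b choose \<beta> b) * (d \<bullet> b) ^ (\<alpha> b - \<beta> b)) * c \<alpha>)) ?I" .
  qed
qed

lemma real_analytic_at_nearby:
  fixes f :: "'a::euclidean_space \<Rightarrow> real"
  assumes "real_analytic_at f p"
  shows "\<forall>\<^sub>F q in nhds p. real_analytic_at f q"
proof -
  obtain r c where r: "r > 0"
    and series: "\<And>x. x \<in> ball p r \<Longrightarrow>
      ((\<lambda>\<alpha>. monomial (x - p) \<alpha> * c \<alpha>) has_sum f x) multi_indices"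
    using assms unfolding real_analytic_at_def monomial_def real_scaleR_def by blast
  have "real_analytic_at f q" if q: "q \<in> ball p r" for q
    unfolding real_analytic_at_def
  proof (intro exI conjI ballI)
    show "0 < r - norm (q - p)"
      using q by (simp add: dist_norm norm_minus_commute)
    fix x assume "x \<in> ball q (r - norm (q - p))"
    then have "norm (q - p) + norm (x - q) < r"
      by (simp add: dist_norm norm_minus_commute)
    from power_series_recentre[OF series this]
    show "((\<lambda>\<beta>. (\<Prod>b\<in>Basis. ((x - q) \<bullet> b) ^ \<beta> b) *\<^sub>R
        (\<Sum>\<^sub>\<infinity>\<alpha>\<in>multi_indices. (\<Prod>b\<in>Basis. of_nat (\<alpha> b choose \<beta> b) * ((q - p) \<bullet> b) ^ (\<alpha> b - \<beta> b)) * c \<alpha>))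
        has_sum f x) multi_indices"
      by (simp add: monomial_def)
  qed
  then show ?thesis
    using r unfolding eventually_nhds_metric by (intro exI[of _ r]) (auto simp: dist_commute)
qed

lemma real_analytic_at_inner:
  fixes f :: "'a::euclidean_space \<Rightarrow> 'b::real_inner"
  assumes "real_analytic_at f p"
  shows "real_analytic_at (\<lambda>x. f x \<bullet> w) p"
proof -
  obtain r c where "r > 0" and series: "\<And>x. x \<in> ball p r \<Longrightarrow>
      ((\<lambda>\<alpha>. (\<Prod>b\<in>Basis. ((x - p) \<bullet> b) ^ \<alpha> b) *\<^sub>R c \<alpha>) has_sum f x) multi_indices"
    using assms unfolding real_analytic_at_def by blast
  moreover have "((\<lambda>\<alpha>. (\<Prod>b\<in>Basis. ((x - p) \<bullet> b) ^ \<alpha> b) *\<^sub>R (c \<alpha> \<bullet> w)) has_sum f x \<bullet> w) multi_indices"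
    if "x \<in> ball p r" for x
    using has_sum_bounded_linear[OF bounded_linear_inner_left[of w] series[OF that]] by simp
  ultimately show ?thesis
    unfolding real_analytic_at_def by (intro exI[of _ r] conjI exI[of _ "\<lambda>\<alpha>. c \<alpha> \<bullet> w"]) auto
qed

section \<open>Derivatives and gradients of smooth maps\<close>

text \<open>Smoothness on a set provides an open neighbourhood on which the map is smooth, so
  derivatives at a boundary point of the set are two-sided.\<close>

lemma smooth_on_set_neighbourhood:
  assumes "smooth_on_set f S"
  obtains U where "open U" "S \<subseteq> U" "smooth_on_set f U"
  using assms by (auto simp: smooth_on_set_def)

lemma smooth_on_set_isCont:
  assumes "smooth_on_set f S" "x \<in> S"
  shows "isCont f x"
proof -
  obtain U where "open U" "S \<subseteq> U" "Cr_on 0 U f"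
    using assms(1) unfolding smooth_on_set_def by blast
  then show ?thesis using assms(2) by (auto simp: continuous_on_eq_continuous_at)
qed

lemma smooth_on_set_has_derivative:
  assumes "smooth_on_set f S" "x \<in> S"
  shows "(f has_derivative frechet_derivative f (at x)) (at x)"
proof -
  obtain U where "open U" "S \<subseteq> U" "Cr_on (Suc 0) U f"
    using assms(1) unfolding smooth_on_set_def by blast
  then have "f differentiable at x"
    using assms(2) by (auto simp: differentiable_on_eq_differentiable_at)
  then show ?thesis by (simp add: frechet_derivative_works)
qed

lemma smooth_on_set_frechet_derivative:
  "smooth_on_set f S \<Longrightarrow> smooth_on_set (\<lambda>x. frechet_derivative f (at x) v) S"
  unfolding smooth_on_set_def by (metis Cr_on.simps(2))

text \<open>On a compact ball inside the domain of smoothness the finitely many partial derivatives are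
  bounded, and the operator norm of the derivative is at most the sum of these bounds.\<close>

lemma smooth_imp_locally_lipschitz:
  fixes f :: "'a::euclidean_space \<Rightarrow> 'b::real_normed_vector"
  assumes "smooth_on_set f S" "x \<in> S"
  obtains r L where "r > 0" "L-lipschitz_on (cball x r) f"
proof -
  obtain U where U: "open U" "S \<subseteq> U" "smooth_on_set f U"
    using smooth_on_set_neighbourhood[OF assms(1)] by metis
  then obtain r where r: "r > 0" "cball x r \<subseteq> U"
    using assms(2) by (metis open_contains_cball subsetD)
  have "\<exists>C. \<forall>y\<in>cball x r. norm (frechet_derivative f (at y) b) \<le> C" for b
  proof -
    have "continuous_on (cball x r) (\<lambda>y. frechet_derivative f (at y) b)"
      using smooth_on_set_isCont[OF smooth_on_set_frechet_derivative[OF U(3)]] r(2)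
      by (intro continuous_at_imp_continuous_on) auto
    then have "bounded ((\<lambda>y. frechet_derivative f (at y) b) ` cball x r)"
      by (intro compact_imp_bounded compact_continuous_image) auto
    then show ?thesis by (auto simp: bounded_iff)
  qed
  then obtain C where C: "\<And>b y. y \<in> cball x r \<Longrightarrow> norm (frechet_derivative f (at y) b) \<le> C b"
    by metis
  define L where "L = (\<Sum>b\<in>Basis. C b)"
  have "L-lipschitz_on (cball x r) f"
  proof (rule bounded_derivative_imp_lipschitz)
    fix y assume y: "y \<in> cball x r"
    let ?D = "frechet_derivative f (at y)"
    have D: "(f has_derivative ?D) (at y)"
      using smooth_on_set_has_derivative[OF U(3)] y r(2) by blast
    then show "(f has_derivative ?D) (at y within cball x r)" by (rule has_derivative_at_withinI)
    have lin: "linear ?D" using D by (rule has_derivative_linear)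
    show "onorm ?D \<le> L"
    proof (rule onorm_le)
      fix v
      have "?D v = ?D (\<Sum>b\<in>Basis. (v \<bullet> b) *\<^sub>R b)" by (simp add: euclidean_representation)
      also have "\<dots> = (\<Sum>b\<in>Basis. (v \<bullet> b) *\<^sub>R ?D b)"
        by (simp add: linear_sum[OF lin] linear_cmul[OF lin])
      also have "norm \<dots> \<le> (\<Sum>b\<in>Basis. norm v * C b)"
        using C[OF y] by (intro sum_norm_le) (auto intro!: mult_mono Basis_le_norm)
      finally show "norm (?D v) \<le> L * norm v"
        by (simp add: L_def sum_distrib_left mult.commute)
    qed
  next
    have "0 \<le> C b" for b
      using order_trans[OF norm_ge_zero C[of x b]] r(1) by simp
    then show "0 \<le> L" by (simp add: L_def sum_nonneg)
  qed auto
  with r(1) show thesis by (rule that)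
qed

lemma gradient_eqI:
  assumes "GDERIV f x :> D"
  shows "gradient f x = D"
  unfolding gradient_def
proof (rule the_equality)
  fix D' assume "GDERIV f x :> D'"
  then have "(\<lambda>h. h \<bullet> D') = (\<lambda>h. h \<bullet> D)"
    using assms by (auto simp: gderiv_def intro: has_derivative_unique)
  then have "(D' - D) \<bullet> D' = (D' - D) \<bullet> D" by meson
  then have "(D' - D) \<bullet> (D' - D) = 0" by (simp add: inner_diff_right)
  then show "D' = D" by simp
qed fact

lemma GDERIV_of_has_derivative:
  fixes f :: "'a::euclidean_space \<Rightarrow> real"
  assumes "(f has_derivative f') (at x)"
  shows "GDERIV f x :> (\<Sum>b\<in>Basis. f' b *\<^sub>R b)"
proof -
  have lin: "linear f'" using assms by (rule has_derivative_linear)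
  have "f' v = v \<bullet> (\<Sum>b\<in>Basis. f' b *\<^sub>R b)" for v
  proof -
    have "f' v = f' (\<Sum>b\<in>Basis. (v \<bullet> b) *\<^sub>R b)" by (simp add: euclidean_representation)
    also have "\<dots> = (\<Sum>b\<in>Basis. (v \<bullet> b) * f' b)"
      by (simp add: linear_sum[OF lin] linear_cmul[OF lin])
    finally show ?thesis by (simp add: inner_sum_right mult.commute)
  qed
  then have "f' = (\<lambda>v. v \<bullet> (\<Sum>b\<in>Basis. f' b *\<^sub>R b))" by (rule ext)
  then show ?thesis
    using assms unfolding gderiv_def by metis
qed

lemmas gradient_eq_sum = gradient_eqI[OF GDERIV_of_has_derivative]

lemma inner_gradient:
  fixes f :: "'a::euclidean_space \<Rightarrow> real"
  assumes "(f has_derivative f') (at x)"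
  shows "v \<bullet> gradient f x = f' v"
proof -
  have "(f has_derivative (\<lambda>v. v \<bullet> gradient f x)) (at x)"
    using GDERIV_of_has_derivative[OF assms] unfolding gradient_eq_sum[OF assms] gderiv_def .
  from has_derivative_unique[OF this assms] show ?thesis by meson
qed

lemma has_derivative_state_slice:
  assumes "(f has_derivative f') (at (l, x))"
  shows "((\<lambda>y. f (l, y)) has_derivative (\<lambda>v. f' (0, v))) (at x)"
proof -
  have "((\<lambda>y. (l, y)) has_derivative (\<lambda>v. (0, v))) (at x)"
    by (intro derivative_intros)
  from has_derivative_compose[OF this] assms show ?thesis by blast
qed

lemma jac_state_mult:
  assumes "(f has_derivative f') (at p)"
  shows "jac_state f p *v v = f' (0, v)"
proof -
  have D: "((\<lambda>y. f (fst p, y)) has_derivative (\<lambda>v. f' (0, v))) (at (snd p))"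
    using assms by (intro has_derivative_state_slice) simp
  then have "((\<lambda>y. f (fst p, y)) has_derivative (\<lambda>v. jac_state f p *v v)) (at (snd p))"
    unfolding jac_state_def by (subst jacobian_works[symmetric]) (rule differentiableI)
  from has_derivative_unique[OF this D] show ?thesis by meson
qed

lemma smooth_on_set_gradient_eq:
  assumes "smooth_on_set h S" "x \<in> S"
  shows "gradient h x = (\<Sum>b\<in>Basis. frechet_derivative h (at x) b *\<^sub>R b)"
  by (rule gradient_eq_sum[OF smooth_on_set_has_derivative[OF assms]])

lemma isCont_gradient:
  fixes h :: "'a::euclidean_space \<Rightarrow> real"
  assumes "smooth_on_set h UNIV"
  shows "isCont (gradient h) x"
proof -
  have "gradient h = (\<lambda>x. \<Sum>b\<in>Basis. frechet_derivative h (at x) b *\<^sub>R b)"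
    using smooth_on_set_gradient_eq[OF assms] by auto
  moreover have "isCont (\<lambda>x. \<Sum>b\<in>Basis. frechet_derivative h (at x) b *\<^sub>R b) x"
    by (intro continuous_intros smooth_on_set_isCont[OF smooth_on_set_frechet_derivative[OF assms]]) simp
  ultimately show ?thesis by simp
qed

section \<open>Local solutions and first integrals\<close>

text \<open>The solution is the fixed point of the integral operator
  \<open>u \<mapsto> (t \<mapsto> x0 + integral {0..t} (F \<circ> u))\<close> on continuous curves in the ball, with the sup
  metric. Bounded continuous functions on the whole line serve as the complete space: curves on
  \<open>{0..T}\<close> are continued by constants, which is the effect of \<open>clamp 0 T\<close>.\<close>

lemma picard_lindelof:
  fixes F :: "'a::euclidean_space \<Rightarrow> 'a"
  assumes L: "L-lipschitz_on (cball x0 r) F" and r: "r > 0"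
  obtains T x where "T > 0" "x 0 = x0"
    "\<And>t. t \<in> {0..T} \<Longrightarrow> x t \<in> cball x0 r"
    "\<And>t. t \<in> {0..T} \<Longrightarrow> (x has_vector_derivative F (x t)) (at t within {0..T})"
proof -
  have L0: "L \<ge> 0" using L by (rule lipschitz_on_nonneg)
  define B where "B = norm (F x0) + L * r + 1"
  have B: "norm (F y) \<le> B" if "y \<in> cball x0 r" for y
  proof -
    have "norm (F y) \<le> norm (F x0) + dist (F x0) (F y)"
      using norm_triangle_ineq2[of "F y" "F x0"] by (simp add: dist_norm norm_minus_commute)
    also have "dist (F x0) (F y) \<le> L * dist x0 y"
      using L that r by (intro lipschitz_onD) auto
    also have "\<dots> \<le> L * r" using that L0 by (intro mult_left_mono) auto
    finally show ?thesis by (simp add: B_def)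
  qed
  have B1: "B \<ge> 1" using L0 r by (simp add: B_def)
  \<comment> \<open>The first bound keeps the curves in the ball, the second makes the operator contract with factor 1/2.\<close>
  define T where "T = min (r / B) (1 / (2 * (L + 1)))"
  have T: "T > 0" using B1 L0 r by (simp add: T_def)
  have BT: "B * T \<le> r"
  proof -
    have "B * T \<le> B * (r / B)" using B1 by (intro mult_left_mono) (auto simp: T_def)
    then show ?thesis using B1 by simp
  qed
  have LT: "L * T \<le> 1 / 2"
  proof -
    have "L * T \<le> L * (1 / (2 * (L + 1)))" using L0 by (intro mult_left_mono) (auto simp: T_def)
    also have "\<dots> \<le> 1 / 2" using L0 by (simp add: field_simps)
    finally show ?thesis .
  qed
  define S :: "(real \<Rightarrow>\<^sub>C 'a) set" where "S = PiC UNIV (\<lambda>_. cball x0 r)"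
  have S: "u t \<in> cball x0 r" if "u \<in> S" for u t
    using that by (auto simp: S_def mem_PiC_iff)
  have cont: "continuous_on A (\<lambda>s. F (u s))" if "u \<in> S" for u A
    by (rule continuous_on_compose2[OF lipschitz_on_continuous_on[OF L]])
       (use S[OF that] in auto)
  let ?g = "\<lambda>u t. x0 + integral {0..t} (\<lambda>s. F (apply_bcontfun u s))"
  have "\<exists>w::real \<Rightarrow>\<^sub>C 'a. \<forall>t. w t = ?g u (clamp 0 T t)" if "u \<in> S" for u
  proof -
    have "continuous_on (cbox 0 T) (?g u)"
      using indefinite_integral_continuous_1[OF integrable_continuous_real[OF cont[OF that]], of 0 T]
      by (intro continuous_intros) (simp add: cbox_interval)
    from continuous_on_cbox_bcontfunE[OF this] show ?thesis by metis
  qed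
  then obtain \<Phi> :: "(real \<Rightarrow>\<^sub>C 'a) \<Rightarrow> (real \<Rightarrow>\<^sub>C 'a)"
    where \<Phi>: "\<And>u t. u \<in> S \<Longrightarrow> \<Phi> u t = ?g u (clamp 0 T t)"
    by metis
  have clamp: "clamp 0 T t \<in> {0..T}" for t :: real
    using clamp_in_interval[of 0 T t] T by (simp add: cbox_interval)
  have "\<exists>!u\<in>S. \<Phi> u = u"
  proof (rule Banach_fix[where c = "1/2"])
    show "complete S"
      unfolding S_def complete_eq_closed by (intro closed_PiC) auto
    have "const_bcontfun x0 \<in> S" using r by (auto simp: S_def mem_PiC_iff)
    then show "S \<noteq> {}" by auto
    show "\<Phi> ` S \<subseteq> S"
    proof clarify
      fix u assume u: "u \<in> S"
      have "\<Phi> u t \<in> cball x0 r" for t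
      proof -
        have "norm (integral {0..clamp 0 T t} (\<lambda>s. F (u s))) \<le> B * (clamp 0 T t - 0)"
          using clamp[of t] by (intro integral_bound cont u B S) auto
        also have "\<dots> \<le> B * T" using clamp[of t] B1 by (intro mult_left_mono) auto
        finally show ?thesis using BT by (simp add: \<Phi>[OF u] dist_norm)
      qed
      then show "\<Phi> u \<in> S" by (auto simp: S_def mem_PiC_iff)
    qed
    show "dist (\<Phi> u) (\<Phi> v) \<le> 1 / 2 * dist u v" if u: "u \<in> S" and v: "v \<in> S" for u v
    proof (rule dist_bound)
      fix t
      let ?t = "clamp 0 T t"
      have int: "(\<lambda>s. F (apply_bcontfun w s)) integrable_on {0..?t}" if "w \<in> S" for w
        by (intro integrable_continuous_real cont that)
      have "dist (\<Phi> u t) (\<Phi> v t) = norm (integral {0..?t} (\<lambda>s. F (u s) - F (v s)))"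
        by (simp add: \<Phi> u v dist_norm integral_diff int)
      also have "\<dots> \<le> L * dist u v * (?t - 0)"
      proof (rule integral_bound)
        show "continuous_on {0..?t} (\<lambda>s. F (u s) - F (v s))"
          by (intro continuous_intros cont u v)
        fix s
        have "dist (F (u s)) (F (v s)) \<le> L * dist (u s) (v s)"
          by (rule lipschitz_onD[OF L]) (use S u v in auto)
        also have "\<dots> \<le> L * dist u v" using L0 by (intro mult_left_mono dist_bounded)
        finally show "norm (F (u s) - F (v s)) \<le> L * dist u v" by (simp add: dist_norm)
      qed (use clamp[of t] in auto)
      also have "\<dots> \<le> L * dist u v * T"
        using clamp[of t] L0 by (intro mult_left_mono) auto
      also have "\<dots> = L * T * dist u v" by simp
      also have "\<dots> \<le> 1 / 2 * dist u v" using LT by (intro mult_right_mono) auto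
      finally show "dist (\<Phi> u t) (\<Phi> v t) \<le> 1 / 2 * dist u v" .
    qed
  qed auto
  then obtain u where u: "u \<in> S" "\<Phi> u = u" by blast
  have eq: "u t = ?g u t" if "t \<in> {0..T}" for t
    using \<Phi>[OF u(1), of t] that u(2) by (simp add: cbox_interval)
  show thesis
  proof (rule that[OF T, of "apply_bcontfun u"])
    show "u 0 = x0" using eq[of 0] T by simp
    show "u t \<in> cball x0 r" for t using S u by blast
    fix t assume t: "t \<in> {0..T}"
    have "(?g u has_vector_derivative 0 + F (u t)) (at t within {0..T})"
      by (intro has_vector_derivative_add has_vector_derivative_const
          integral_has_vector_derivative cont u t)
    then show "(u has_vector_derivative F (u t)) (at t within {0..T})"
      using has_vector_derivative_transform[OF t eq, of _ "F (u t)"] by simp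
  qed
qed

text \<open>Along the local solution through \<open>x\<close> the function \<open>h\<close> is constant, and its derivative at
  time \<open>0\<close> is \<open>h' (F x)\<close>.\<close>

lemma first_integral_derivative_zero:
  fixes F :: "'a::euclidean_space \<Rightarrow> 'a"
  assumes "first_integral_on V F h" "L-lipschitz_on (cball x r) F" "r > 0" "cball x r \<subseteq> V"
    and h': "(h has_derivative h') (at x)"
  shows "h' (F x) = 0"
proof -
  obtain T u where T: "T > 0" "u 0 = x"
    and u: "\<And>t. t \<in> {0..T} \<Longrightarrow> u t \<in> cball x r"
      "\<And>t. t \<in> {0..T} \<Longrightarrow> (u has_vector_derivative F (u t)) (at t within {0..T})"
    using picard_lindelof[OF assms(2,3)] by metis
  have "solution_in V F {0..T} u"
    using u assms(4) by (auto simp: solution_in_def is_interval_cc)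
  then have "(\<lambda>t. h (u t)) constant_on {0..T}"
    using assms(1) by (auto simp: first_integral_on_def)
  then obtain c where c: "\<And>t. t \<in> {0..T} \<Longrightarrow> h (u t) = c"
    by (auto simp: constant_on_def)
  have "((\<lambda>_. c) has_vector_derivative 0) (at 0 within {0..T})" by simp
  then have zero: "((\<lambda>t. h (u t)) has_vector_derivative 0) (at 0 within {0..T})"
    by (rule has_vector_derivative_transform[rotated 2]) (use T c in auto)
  have "(u has_derivative (\<lambda>t. t *\<^sub>R F x)) (at 0 within {0..T})"
    using u(2)[of 0] T by (simp add: has_vector_derivative_def)
  moreover have "(h has_derivative h') (at (u 0))" using h' T by simp
  ultimately have "((\<lambda>t. h (u t)) has_derivative (\<lambda>t. h' (t *\<^sub>R F x))) (at 0 within {0..T})"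
    by (rule has_derivative_compose)
  moreover have "h' (t *\<^sub>R F x) = t *\<^sub>R h' (F x)" for t
    using has_derivative_linear[OF h'] by (simp add: linear_cmul)
  ultimately have "((\<lambda>t. h (u t)) has_vector_derivative h' (F x)) (at 0 within {0..T})"
    by (simp add: has_vector_derivative_def)
  moreover have "at 0 within {0..T} \<noteq> bot"
    using T by (simp add: at_within_Icc_at_right)
  ultimately show ?thesis
    using vector_derivative_unique_within zero by blast
qed

section \<open>First integrals constrain the vector field on the whole domain\<close>

text \<open>Points of a half space with positive \<open>i\<close>-th coordinate are dense in it. The inverse of a
  chart carries a small open set of such points to a subset of \<open>V\<close> which is open in the ambient
  space by invariance of domain, and which is as close to the given point as desired.\<close>

lemma codim_zero_submanifold_subset_closure_interior:
  fixes V :: "(real^'n) set"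
  assumes "codim_zero_submanifold V"
  shows "V \<subseteq> closure (interior V)"
proof
  fix x assume "x \<in> V"
  then obtain U W i where U: "openin (top_of_set V) U" "x \<in> U"
    and W: "openin (top_of_set {y::real^'n. 0 \<le> y $ i}) W" and "U homeomorphic W"
    using assms unfolding codim_zero_submanifold_def by metis
  then obtain \<phi> \<psi> where hom: "homeomorphism U W \<phi> \<psi>"
    by (auto simp: homeomorphic_def)
  show "x \<in> closure (interior V)"
    unfolding closure_iff_nhds_not_empty
  proof (intro allI impI)
    fix A N assume "N \<subseteq> A" "open N" "x \<in> N"
    have "openin (top_of_set W) (\<phi> ` (U \<inter> N))"
      using homeomorphism_imp_open_map[OF hom] \<open>open N\<close> by (metis openin_open_Int)
    then have "openin (top_of_set {y::real^'n. 0 \<le> y $ i}) (\<phi> ` (U \<inter> N))"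
      using W openin_trans by blast
    then obtain O' where O': "open O'" "\<phi> ` (U \<inter> N) = {y. 0 \<le> y $ i} \<inter> O'"
      by (auto simp: openin_open)
    \<comment> \<open>The part of the chart image of \<open>N\<close> away from the boundary of the half space.\<close>
    define G where "G = O' \<inter> {y. 0 < y $ i}"
    have G: "open G" "G \<subseteq> \<phi> ` (U \<inter> N)"
      using O' by (auto simp: G_def intro!: open_Int open_Collect_less continuous_intros)
    have "\<phi> x \<in> O'" "0 \<le> \<phi> x $ i" using O'(2) \<open>x \<in> U\<close> \<open>x \<in> N\<close> by auto
    then obtain e where e: "e > 0" "ball (\<phi> x) e \<subseteq> O'"
      using O'(1) by (auto simp: open_contains_ball)
    have "\<phi> x + (e/2) *\<^sub>R axis i 1 \<in> G"
      using e \<open>0 \<le> \<phi> x $ i\<close> by (auto simp: G_def dist_norm norm_axis_1 intro!: subsetD[OF e(2)])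
    then have "G \<noteq> {}" by auto
    have "open (\<psi> ` G)"
    proof (rule invariance_of_domain)
      have "G \<subseteq> W" using G(2) hom by (auto simp: homeomorphism_def)
      then show "continuous_on G \<psi>" "inj_on \<psi> G"
        using hom by (auto simp: homeomorphism_def intro: continuous_on_subset intro!: inj_on_inverseI[of G \<phi>])
    qed fact
    moreover have sub: "\<psi> ` G \<subseteq> U \<inter> N"
      using G(2) hom by (force simp: homeomorphism_def)
    moreover have "U \<subseteq> V" using U(1) by (rule openin_imp_subset)
    ultimately have "\<psi> ` G \<subseteq> interior V" by (intro interior_maximal) auto
    then show "interior V \<inter> A \<noteq> {}" using sub \<open>N \<subseteq> A\<close> \<open>G \<noteq> {}\<close> by blast
  qed
qed

text \<open>At an interior point a solution through it exists and stays in \<open>V\<close> for a short time; at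
  boundary points, where solutions might leave \<open>V\<close> at once, the identity holds by continuity.\<close>

lemma first_integral_gradient_orthogonal:
  fixes f :: "'m::euclidean_space \<times> 'n::euclidean_space \<Rightarrow> 'n"
  assumes f: "smooth_on_set f (\<Lambda> \<times> V)" and h: "smooth_on_set h UNIV"
    and V: "closure (interior V) = V"
    and l: "l \<in> \<Lambda>" and fi: "first_integral_on V (\<lambda>x. f (l, x)) h" and x: "x \<in> V"
  shows "f (l, x) \<bullet> gradient h x = 0"
proof (rule continuous_constant_on_closure[where S = "interior V" and x = x
      and f = "\<lambda>x. f (l, x) \<bullet> gradient h x"])
  show "x \<in> closure (interior V)" using x V by simp
  show "continuous_on (closure (interior V)) (\<lambda>x. f (l, x) \<bullet> gradient h x)"
  proof (rule continuous_at_imp_continuous_on, rule ballI)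
    fix y assume "y \<in> closure (interior V)"
    then have "isCont f (l, y)" using l V by (intro smooth_on_set_isCont[OF f]) auto
    then have "isCont (\<lambda>y. f (l, y)) y"
      by (intro isCont_o2[where f = "\<lambda>y. (l, y)" and g = f]) (auto intro!: continuous_intros)
    then show "isCont (\<lambda>y. f (l, y) \<bullet> gradient h y) y"
      by (intro continuous_intros isCont_gradient h)
  qed
  fix y assume y: "y \<in> interior V"
  then have ly: "(l, y) \<in> \<Lambda> \<times> V" using l interior_subset by blast
  obtain r L where r: "r > 0" "L-lipschitz_on (cball (l, y) r) f"
    using smooth_imp_locally_lipschitz[OF f ly] by metis
  obtain s where s: "s > 0" "cball y s \<subseteq> V"
    using y by (auto simp: mem_interior_cball)
  have lip: "L-lipschitz_on (cball y (min r s)) (\<lambda>x. f (l, x))"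
  proof (rule lipschitz_onI)
    fix u v assume "u \<in> cball y (min r s)" "v \<in> cball y (min r s)"
    then have "dist (f (l, u)) (f (l, v)) \<le> L * dist (l, u) (l, v)"
      by (intro lipschitz_onD[OF r(2)]) (auto simp: dist_Pair_Pair)
    then show "dist (f (l, u)) (f (l, v)) \<le> L * dist u v" by (simp add: dist_Pair_Pair)
  qed (rule lipschitz_on_nonneg[OF r(2)])
  have D: "(h has_derivative frechet_derivative h (at y)) (at y)"
    by (rule smooth_on_set_has_derivative[OF h]) simp
  have "frechet_derivative h (at y) (f (l, y)) = 0"
    using r(1) s by (intro first_integral_derivative_zero[OF fi lip _ _ D]) auto
  then show "f (l, y) \<bullet> gradient h y = 0" by (simp add: inner_gradient[OF D])
qed

text \<open>On the interior of \<open>V\<close> the identity \<open>f \<bullet> \<nabla>h = 0\<close> can be differentiated in the direction \<open>v\<close>.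
  The resulting identity \<open>\<psi> = 0\<close> consists of continuous terms, so it holds on \<open>V\<close>, and at an
  equilibrium its first summand drops out.\<close>

lemma image_state_derivative_orthogonal:
  fixes f :: "'m::euclidean_space \<times> 'n::euclidean_space \<Rightarrow> 'n"
  assumes f: "smooth_on_set f (\<Lambda> \<times> V)" and h: "smooth_on_set h UNIV"
    and V: "closure (interior V) = V"
    and l: "l \<in> \<Lambda>" and fi: "first_integral_on V (\<lambda>x. f (l, x)) h" and x: "x \<in> V"
    and zero: "f (l, x) = 0"
  shows "frechet_derivative f (at (l, x)) (0, v) \<bullet> gradient h x = 0"
proof -
  let ?H = "\<lambda>y. \<Sum>b\<in>Basis. frechet_derivative (\<lambda>z. frechet_derivative h (at z) b) (at y) v *\<^sub>R b"
  let ?\<psi> = "\<lambda>y. f (l, y) \<bullet> ?H y + frechet_derivative f (at (l, y)) (0, v) \<bullet> gradient h y"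
  note dh = smooth_on_set_frechet_derivative[OF h]
  have cont_slice: "isCont (\<lambda>y. g (l, y)) y"
    if "smooth_on_set g (\<Lambda> \<times> V)" "y \<in> V" for g :: "'m \<times> 'n \<Rightarrow> 'n" and y
  proof -
    have "isCont g (l, y)" using that l by (intro smooth_on_set_isCont[OF that(1)]) auto
    then show ?thesis
      by (intro isCont_o2[where f = "\<lambda>y. (l, y)" and g = g]) (auto intro!: continuous_intros)
  qed
  have "?\<psi> x = 0"
  proof (rule continuous_constant_on_closure[where S = "interior V" and x = x and f = ?\<psi>])
    show "x \<in> closure (interior V)" using x V by simp
    show "continuous_on (closure (interior V)) ?\<psi>"
    proof (rule continuous_at_imp_continuous_on, rule ballI)
      fix y assume "y \<in> closure (interior V)"
      then have y: "y \<in> V" using V by simp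
      have H: "isCont ?H y"
        by (intro continuous_intros smooth_on_set_isCont[OF smooth_on_set_frechet_derivative[OF dh]]) simp
      show "isCont ?\<psi> y"
        by (intro continuous_add continuous_inner H isCont_gradient h
            cont_slice[OF f y] cont_slice[OF smooth_on_set_frechet_derivative[OF f] y])
    qed
    fix y assume y: "y \<in> interior V"
    then have ly: "(l, y) \<in> \<Lambda> \<times> V" using l interior_subset by blast
    have grad: "gradient h = (\<lambda>y. \<Sum>b\<in>Basis. frechet_derivative h (at y) b *\<^sub>R b)"
      using smooth_on_set_gradient_eq[OF h] by auto
    have "(gradient h has_derivative
        (\<lambda>v. \<Sum>b\<in>Basis. frechet_derivative (\<lambda>z. frechet_derivative h (at z) b) (at y) v *\<^sub>R b)) (at y)"
      unfolding grad
      by (intro has_derivative_sum has_derivative_scaleR_left smooth_on_set_has_derivative[OF dh]) simp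
    from has_derivative_inner[OF has_derivative_state_slice[OF smooth_on_set_has_derivative[OF f ly]] this]
    have D: "((\<lambda>y. f (l, y) \<bullet> gradient h y) has_derivative
        (\<lambda>v. f (l, y) \<bullet> (\<Sum>b\<in>Basis. frechet_derivative (\<lambda>z. frechet_derivative h (at z) b) (at y) v *\<^sub>R b)
          + frechet_derivative f (at (l, y)) (0, v) \<bullet> gradient h y)) (at y)" .
    have "((\<lambda>y. f (l, y) \<bullet> gradient h y) has_derivative (\<lambda>v. 0)) (at y)"
    proof (rule has_derivative_transform_within_open[OF has_derivative_const[of 0] open_interior y])
      show "0 = f (l, z) \<bullet> gradient h z" if "z \<in> interior V" for z
        using first_integral_gradient_orthogonal[OF f h V l fi, of z] that interior_subset by force
    qed
    from has_derivative_unique[OF D this] show "?\<psi> y = 0" by meson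
  qed
  then show ?thesis using zero by simp
qed

section \<open>Linear algebra\<close>

text \<open>Injectivity on \<open>W\<close> at \<open>p\<close> means \<open>norm (A p v) \<ge> e * norm v\<close> on \<open>W\<close> for some \<open>e > 0\<close>, and near
  \<open>p\<close> the operators \<open>A q\<close> and \<open>A p\<close> differ by less than \<open>e\<close> in norm.\<close>

lemma linear_injective_on_subspace_nearby:
  fixes A :: "'q::t2_space \<Rightarrow> 'a::euclidean_space \<Rightarrow> 'b::euclidean_space"
  assumes lin: "\<And>q. linear (A q)"
    and cont: "\<And>v. isCont (\<lambda>q. A q v) p"
    and W: "subspace W" "\<And>v. v \<in> W \<Longrightarrow> A p v = 0 \<Longrightarrow> v = 0"
  shows "\<forall>\<^sub>F q in nhds p. \<forall>v\<in>W. A q v = 0 \<longrightarrow> v = 0"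
proof -
  obtain e where e: "e > 0" "\<And>v. v \<in> W \<Longrightarrow> e * norm v \<le> norm (A p v)"
    using injective_imp_isometric[of W "A p"] W lin[of p]
    by (auto simp: closed_subspace linear_conv_bounded_linear)
  define d where "d q = (\<Sum>b\<in>Basis. norm (A p b - A q b))" for q
  have "((\<lambda>q. A q b) \<longlongrightarrow> A p b) (nhds p)" for b
    using cont[of b] tendsto_at_iff_tendsto_nhds[of "\<lambda>q. A q b" p] by (simp add: isCont_def)
  then have "(d \<longlongrightarrow> (\<Sum>b\<in>Basis. norm (A p b - A p b))) (nhds p)"
    unfolding d_def by (intro tendsto_intros)
  then have near: "\<forall>\<^sub>F q in nhds p. d q < e"
    using e(1) by (intro order_tendstoD) auto
  show ?thesis
  proof (rule eventually_mono[OF near], intro ballI impI, rule ccontr)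
    fix q v assume q: "d q < e" and v: "v \<in> W" "A q v = 0" "v \<noteq> 0"
    have expand: "A r v = (\<Sum>b\<in>Basis. (v \<bullet> b) *\<^sub>R A r b)" for r
    proof -
      have "A r v = A r (\<Sum>b\<in>Basis. (v \<bullet> b) *\<^sub>R b)" by (simp add: euclidean_representation)
      then show ?thesis by (simp add: linear_sum[OF lin] linear_cmul[OF lin])
    qed
    have "e * norm v \<le> norm (A p v - A q v)" using e(2) v by simp
    also have "A p v - A q v = (\<Sum>b\<in>Basis. (v \<bullet> b) *\<^sub>R (A p b - A q b))"
      unfolding expand[of p] expand[of q] by (simp add: sum_subtractf scaleR_diff_right)
    also have "norm \<dots> \<le> (\<Sum>b\<in>Basis. norm v * norm (A p b - A q b))"
      by (intro sum_norm_le) (auto intro!: mult_right_mono Basis_le_norm)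
    also have "\<dots> = norm v * d q" by (simp add: d_def sum_distrib_left)
    also have "\<dots> < norm v * e" using q v by simp
    finally show False by (simp add: mult.commute)
  qed
qed

lemma dim_orthogonal_complement_independent_family:
  fixes v :: "'i \<Rightarrow> 'a::euclidean_space"
  assumes "independent_family v I" "finite I"
  shows "dim {u. \<forall>i\<in>I. u \<bullet> v i = 0} + card I = DIM('a)"
proof -
  have v: "inj_on v I" "independent (v ` I)"
    using assms(1) by (auto simp: independent_family_def)
  have "{u \<in> UNIV. \<forall>w\<in>span (v ` I). orthogonal w u} = {u. \<forall>i\<in>I. u \<bullet> v i = 0}"
  proof safe
    fix u i assume "\<forall>w\<in>span (v ` I). orthogonal w u" "i \<in> I"
    then show "u \<bullet> v i = 0"
      by (auto simp: orthogonal_def inner_commute span_base)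
  next
    fix u w assume u: "\<forall>i\<in>I. u \<bullet> v i = 0" and w: "w \<in> span (v ` I)"
    have "orthogonal u w"
      by (rule orthogonal_to_span[OF w]) (use u in \<open>auto simp: orthogonal_def\<close>)
    then show "orthogonal w u" by (simp add: orthogonal_commute)
  qed simp
  then show ?thesis
    using dim_subspace_orthogonal_to_vectors[of "span (v ` I)" UNIV] dim_eq_card_independent[OF v(2)]
    by (simp add: card_image[OF v(1)])
qed

section \<open>The equilibrium locus\<close>

theorem proposition2:
  fixes \<Lambda> :: "(real^'m) set"
    and V :: "(real^'n) set"
    and M E :: "((real^'m) \<times> (real^'n)) set"
    and f :: "(real^'m) \<times> (real^'n) \<Rightarrow> real^'n"
    and k :: nat
    and h :: "nat \<Rightarrow> real^'n \<Rightarrow> real"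
  defines "M \<equiv> \<Lambda> \<times> V"
    and "E \<equiv> {p \<in> M. f p = 0}"
  assumes k_pos: "0 < k"
    and Lambda: "open \<Lambda>" "connected \<Lambda>"
    and V: "compact V" "codim_zero_submanifold V" "stratified_manifold (frontier V)"
    and f_smooth: "smooth_on_set f M"
    and stays_inside: "\<And>l x. l \<in> \<Lambda> \<Longrightarrow> x \<in> frontier V \<Longrightarrow>
          points_inward V x (f (l, x)) \<or> f (l, x) \<in> tangent_cone (frontier V) x"
    and h_smooth: "\<And>i. i < k \<Longrightarrow> smooth_on_set (h i) UNIV"
    and h_first_integral: "\<And>i l. i < k \<Longrightarrow> l \<in> \<Lambda> \<Longrightarrow> first_integral_on V (\<lambda>x. f (l, x)) (h i)"
    and h_independent: "\<And>x. independent_family (\<lambda>i. gradient (h i) x) {..<k}"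
    and E_nonempty: "E \<noteq> {}"
    and nondeg_i: "\<And>p. p \<in> M \<Longrightarrow> rank (jac_param f p) = min CARD('m) (CARD('n) - k)"
    and nondeg_ii_on_E: "\<And>p. p \<in> E \<Longrightarrow> rank (jac_state f p) = CARD('n) - k"
    and nondeg_ii_off_E: "\<And>p. p \<in> M - E \<Longrightarrow> \<exists>r\<le>k. rank (jac_state f p) = CARD('n) - r"
    and nondeg_iii: "\<And>p. p \<in> E \<Longrightarrow>
          direct_sum_UNIV {v. jac_state f p *v v = 0} (range (\<lambda>v. jac_state f p *v v))"
    and f_analytic: "real_analytic_on_set f M"
  shows "smooth_analytic_variety_in (CARD('m) + k) M E"
proof -
  have cl: "closure (interior V) = V"
    using codim_zero_submanifold_subset_closure_interior[OF V(2)] compact_imp_closed[OF V(1)]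
    by (simp add: closure_minimal interior_subset subset_antisym)
  note f' = f_smooth[unfolded M_def]
  have k_le: "k \<le> CARD('n)"
    using dim_orthogonal_complement_independent_family[OF h_independent, of 0] by simp
  have codim: "DIM((real^'m) \<times> (real^'n)) - (CARD('m) + k) = CARD('n) - k" by simp
  have tangent: "f q \<bullet> gradient (h i) (snd q) = 0" if "q \<in> M" "i < k" for q i
    using first_integral_gradient_orthogonal[OF f' h_smooth cl _ h_first_integral, of i "fst q" "snd q"]
      that by (auto simp: M_def)
  have local: "\<exists>U g. open U \<and> p \<in> U \<and>
      (\<forall>i<CARD('n) - k. real_analytic_on_set (g i) U) \<and>
      (\<forall>q\<in>U. independent_family (\<lambda>i. gradient (g i) q) {..<CARD('n) - k}) \<and>
      E \<inter> U = {q \<in> M \<inter> U. \<forall>i<CARD('n) - k. g i q = 0}" if "p \<in> E" for p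
  proof -
    have p: "p \<in> M" "f p = 0" using that by (auto simp: E_def)
    obtain N where N: "open N" "M \<subseteq> N" "smooth_on_set f N"
      using smooth_on_set_neighbourhood[OF f_smooth] .
    let ?Df = "\<lambda>q. frechet_derivative f (at q)"
    have Df: "(f has_derivative ?Df q) (at q)" if "q \<in> N" for q
      using smooth_on_set_has_derivative[OF N(3) that] .
    have pN: "p \<in> N" using p N by blast
    \<comment> \<open>The image of the state derivative is contained in the kernel of all \<open>dh\<^sub>i\<close>, and dimensions agree.\<close>
    define W where "W = range (\<lambda>v. jac_state f p *v v)"
    have W_eq: "W = range (\<lambda>v. ?Df p (0, v))"
      by (simp add: W_def jac_state_mult[OF Df[OF pN]])
    have W: "subspace W"
      unfolding W_def by (intro linear_subspace_image) (auto simp: matrix_vector_mul_linear)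
    have W_kernel: "W = {u. \<forall>i\<in>{..<k}. u \<bullet> gradient (h i) (snd p) = 0}" (is "W = ?K")
    proof (rule subspace_dim_equal[OF W])
      show "subspace ?K" by (auto simp: subspace_def inner_add_left)
      show "W \<subseteq> ?K"
        using image_state_derivative_orthogonal[OF f' h_smooth cl _ h_first_integral, of _ "fst p" "snd p"] p
        by (auto simp: W_eq M_def)
      show "dim ?K \<le> dim W"
        using dim_orthogonal_complement_independent_family[OF h_independent, of "snd p"]
          nondeg_ii_on_E[OF that] by (simp add: W_def rank_dim_range)
    qed
    have dim_W: "dim W = CARD('n) - k"
      using nondeg_ii_on_E[OF that] by (simp add: W_def rank_dim_range)
    obtain B where B: "B \<subseteq> W" "independent B" "W \<subseteq> span B" "card B = dim W"
      using basis_exists[of W] by metis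
    have span_B: "span B = W" using B W by (simp add: span_minimal subset_antisym)
    have "finite B" using B(2) by (rule independent_imp_finite)
    then obtain w where w: "bij_betw w {..<CARD('n) - k} B"
      using ex_bij_betw_nat_finite[of B] B(4) dim_W by (auto simp: atLeast0LessThan)
    define g where "g i q = f q \<bullet> w i" for i q

    \<comment> \<open>Where \<open>f\<close> is differentiable, \<open>A q u\<close> is the gradient of \<open>f \<bullet> u\<close>; this formula is linear in
      \<open>u\<close> for every \<open>q\<close>.\<close>
    define A where "A q u = (\<Sum>b\<in>Basis. (?Df q b \<bullet> u) *\<^sub>R b)" for q u
    have g_deriv: "((\<lambda>q. f q \<bullet> u) has_derivative (\<lambda>v. ?Df q v \<bullet> u)) (at q)" if "q \<in> N" for q u
      using Df[OF that] by (intro has_derivative_inner_left)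
    have A_gradient: "A q u = gradient (\<lambda>q. f q \<bullet> u) q" if "q \<in> N" for q u
      by (simp add: A_def gradient_eq_sum[OF g_deriv[OF that]])
    have A_linear: "linear (A q)" for q
      by (rule linearI)
        (simp_all add: A_def inner_add_right scaleR_add_left sum.distrib scaleR_sum_right)
    have "\<forall>\<^sub>F q in nhds p. \<forall>u\<in>W. A q u = 0 \<longrightarrow> u = 0"
    proof (rule linear_injective_on_subspace_nearby[OF A_linear _ W])
      show "isCont (\<lambda>q. A q v) p" for v
        unfolding A_def
        by (intro continuous_intros smooth_on_set_isCont[OF smooth_on_set_frechet_derivative[OF N(3)]] pN)
      fix u assume "u \<in> W" and A0: "A p u = 0"
      then obtain v where v: "u = ?Df p (0, v)" by (auto simp: W_eq)
      \<comment> \<open>Pairing \<open>A p u\<close> with the increment that produces \<open>u\<close> gives \<open>u \<bullet> u\<close>.\<close>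
      have "?Df p (0, v) \<bullet> u = (0, v) \<bullet> A p u"
        by (simp add: A_gradient pN inner_gradient[OF g_deriv[OF pN]])
      then show "u = 0" using A0 v by simp
    qed
    moreover
    \<comment> \<open>\<open>C q\<close> is the Gram operator of the gradients of the first integrals. Its kernel is their
      orthogonal complement, and its target does not depend on \<open>k\<close>.\<close>
    define C where "C q u = (\<Sum>i<k. (u \<bullet> gradient (h i) (snd q)) *\<^sub>R gradient (h i) (snd q))"
      for q :: "(real^'m) \<times> (real^'n)" and u
    have "\<forall>\<^sub>F q in nhds p. \<forall>u\<in>{u. \<forall>x\<in>W. orthogonal x u}. C q u = 0 \<longrightarrow> u = 0"
    proof (rule linear_injective_on_subspace_nearby)
      show "linear (C q)" for q
        by (rule linearI)
          (simp_all add: C_def inner_add_left scaleR_add_left sum.distrib scaleR_sum_right)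
      have "isCont (\<lambda>q. gradient (h i) (snd q)) p" if "i < k" for i
        by (intro isCont_o2[where f = snd and g = "gradient (h i)"] isCont_gradient h_smooth that continuous_intros)
      then show "isCont (\<lambda>q. C q v) p" for v
        unfolding C_def by (intro continuous_intros) auto
      show "subspace {u. \<forall>x\<in>W. orthogonal x u}" by (rule subspace_orthogonal_to_vectors)
      fix u assume u: "u \<in> {u. \<forall>x\<in>W. orthogonal x u}" and "C p u = 0"
      then have "u \<bullet> C p u = 0" by simp
      then have "(\<Sum>i<k. (u \<bullet> gradient (h i) (snd p))\<^sup>2) = 0"
        by (simp add: C_def inner_sum_right power2_eq_square)
      then have "u \<in> W" by (simp add: W_kernel sum_nonneg_eq_0_iff)
      then show "u = 0" using u by (auto simp: orthogonal_def)
    qed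
    moreover have "\<forall>\<^sub>F q in nhds p. \<forall>i\<in>{..<CARD('n) - k}. real_analytic_at (g i) q"
      unfolding g_def using f_analytic p
      by (intro eventually_ball_finite ballI real_analytic_at_nearby real_analytic_at_inner)
        (auto simp: real_analytic_on_set_def)
    moreover have "\<forall>\<^sub>F q in nhds p. q \<in> N"
      using N(1) pN by (rule eventually_nhds_in_open)
    ultimately have "\<forall>\<^sub>F q in nhds p. q \<in> N \<and> (\<forall>i\<in>{..<CARD('n) - k}. real_analytic_at (g i) q) \<and>
        (\<forall>u\<in>W. A q u = 0 \<longrightarrow> u = 0) \<and> (\<forall>u\<in>{u. \<forall>x\<in>W. orthogonal x u}. C q u = 0 \<longrightarrow> u = 0)"
      by (simp only: eventually_conj_iff simp_thms)
    then obtain U where U: "open U" "p \<in> U" and UN: "\<And>q. q \<in> U \<Longrightarrow> q \<in> N"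
      and U_analytic: "\<And>q i. q \<in> U \<Longrightarrow> i < CARD('n) - k \<Longrightarrow> real_analytic_at (g i) q"
      and U_A: "\<And>q u. q \<in> U \<Longrightarrow> u \<in> W \<Longrightarrow> A q u = 0 \<Longrightarrow> u = 0"
      and U_C: "\<And>q u. q \<in> U \<Longrightarrow> \<forall>x\<in>W. orthogonal x u \<Longrightarrow> C q u = 0 \<Longrightarrow> u = 0"
      unfolding eventually_nhds by auto
    have "independent_family (\<lambda>i. gradient (g i) q) {..<CARD('n) - k}" if q: "q \<in> U" for q
    proof -
      have grad: "(\<lambda>i. gradient (g i) q) = A q \<circ> w"
        using A_gradient[OF UN[OF q]] by (auto simp: g_def[abs_def])
      have inj: "inj_on (A q) (span B)"
        unfolding span_B using U_A[OF q]
        by (subst linear_injective_on_subspace_0[OF A_linear W]) blast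
      have wB: "w ` {..<CARD('n) - k} = B" and "inj_on w {..<CARD('n) - k}"
        using w by (auto simp: bij_betw_def)
      then have "inj_on (A q \<circ> w) {..<CARD('n) - k}"
        using inj_on_subset[OF inj span_superset] by (intro comp_inj_on) auto
      moreover have "independent ((A q \<circ> w) ` {..<CARD('n) - k})"
        unfolding image_comp[symmetric] wB by (rule linear_independent_injective_image[OF A_linear B(2) inj])
      ultimately show ?thesis unfolding independent_family_def grad by (rule conjI)
    qed
    moreover have "E \<inter> U = {q \<in> M \<inter> U. \<forall>i<CARD('n) - k. g i q = 0}"
    proof (intro equalityI subsetI)
      fix q assume "q \<in> {q \<in> M \<inter> U. \<forall>i<CARD('n) - k. g i q = 0}"
      then have q: "q \<in> M" "q \<in> U" and "\<forall>i<CARD('n) - k. f q \<bullet> w i = 0" by (auto simp: g_def)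
      then have "\<forall>b\<in>B. orthogonal (f q) b"
        using w by (auto simp: bij_betw_def orthogonal_def)
      then have "\<forall>x\<in>W. orthogonal x (f q)"
        using orthogonal_to_span[of _ B "f q"] by (auto simp: span_B orthogonal_commute)
      moreover have "C q (f q) = 0" by (simp add: C_def tangent[OF q(1)])
      ultimately have "f q = 0" by (rule U_C[OF q(2)])
      then show "q \<in> E \<inter> U" using q by (auto simp: E_def)
    qed (auto simp: E_def g_def)
    ultimately show ?thesis
      using U U_analytic by (intro exI[of _ U] exI[of _ g]) (auto simp: real_analytic_on_set_def)
  qed
  have "closedin (top_of_set M) E"
    unfolding E_def
    by (intro continuous_closedin_preimage_constant continuous_at_imp_continuous_on ballI
        smooth_on_set_isCont[OF f_smooth])
  moreover have "regular_locus_in real_analytic_on_set (CARD('m) + k) M E"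
    unfolding regular_locus_in_def codim
  proof (intro conjI ballI local)
    show "CARD('m) + k \<le> DIM((real^'m) \<times> (real^'n))" using k_le by simp
    show "E \<subseteq> M" by (auto simp: E_def)
  qed
  ultimately show ?thesis by (simp add: smooth_analytic_variety_in_def)
qed

end
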